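(* Let $(M^{2m},J,g)$ be a standard Kähler manifold and let $(T^{*}M,{}^{BS}g)$ be its cotangent bundle equipped with the Berger-type deformed Sasaki metric. Then the horizontal lift of any geodesic on $(M^{2m},J,g)$ is a geodesic on $(T^{*}M,{}^{BS}g)$.
   Context: All objects are smooth. A standard Kähler manifold $(M^{2m},J,g)$ is a $2m$-dimensional manifold with an almost complex structure $J$ ($J^2=-I$) and a Riemannian metric $g$ with $g(JX,JY)=g(X,Y)$ such that $\nabla J=0$, where $\nabla$ is the Levi-Civita connection of $g$. For a covector $\omega$, $\widetilde\omega$ is the vector with $g(\widetilde\omega,X)=\omega(X)$ for all $X$; $g^{-1}(\omega,\theta)=g(\widetilde\omega,\widetilde\theta)$; $\omega J$ is the covector $(\omega J)(X)=\omega(JX)$. In the coordinates $(x^i,p_i)$ on $T^{*}M$ induced by coordinates $(x^i)$ on $M$, with Christoffel symbols $\Gamma^k_{ij}$ of $g$, the horizontal lift of a vector $X=X^i\partial_{x^i}$ is ${}^{H}X=X^{i}\partial_{x^i}+p_{h}\Gamma^{h}_{ij}X^{j}\partial_{p_i}$ and the vertical lift of a covector $\omega=\omega_idx^i$ is ${}^{V}\omega=\omega_i\partial_{p_i}$. The Berger-type deformed Sasaki metric ${}^{BS}g$ on $T^{*}M$, with real constant $\delta$, is the Riemannian metric defined at $(x,p)$ by ${}^{BS}g({}^{H}X,{}^{H}Y)=g(X,Y)$, ${}^{BS}g({}^{H}X,{}^{V}\theta)=0$, ${}^{BS}g({}^{V}\omega,{}^{V}\theta)=g^{-1}(\omega,\theta)+\delta^{2}g^{-1}(\omega,pJ)\,g^{-1}(\theta,pJ)$.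 A curve $C=(\gamma(t),\vartheta(t))$ on $T^{*}M$ ($\vartheta$ a covector field along the curve $\gamma$ on $M$) is called a horizontal lift of $\gamma$ if $\vartheta'=\nabla_{\gamma'}\vartheta=0$. *)

theory Defs
  imports "HOL-Analysis.Analysis"
begin

section \<open>Smooth maps\<close>

text \<open>
  The derivative is taken within \<open>S\<close>, so that the same notion serves open subsets of
  Euclidean space and (relatively open subsets of) nondegenerate real intervals, which may
  contain their end points.
\<close>

primrec Ck_on ::
  "nat \<Rightarrow> 'b::real_normed_vector set \<Rightarrow> ('b \<Rightarrow> 'c::real_normed_vector) \<Rightarrow> bool" where
  "Ck_on 0 S f \<longleftrightarrow> continuous_on S f"
| "Ck_on (Suc k) S f \<longleftrightarrow>
     f differentiable_on S \<and> (\<forall>v. Ck_on k S (\<lambda>x. frechet_derivative f (at x within S) v))"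

definition smooth_on ::
  "'b::real_normed_vector set \<Rightarrow> ('b \<Rightarrow> 'c::real_normed_vector) \<Rightarrow> bool" where
  "smooth_on S f \<longleftrightarrow> (\<forall>k. Ck_on k S f)"

definition partial_deriv :: "'n::finite \<Rightarrow> (real^'n \<Rightarrow> real) \<Rightarrow> real^'n \<Rightarrow> real" where
  "partial_deriv i f x = frechet_derivative f (at x) (axis i 1)"


section \<open>Smooth manifolds\<close>

text \<open>
  An atlas is an indexed family of charts with values in \<open>real^'n\<close>.  Only the values of
  \<open>chart_map A c\<close> on \<open>chart_dom A c\<close> are relevant.
\<close>

record ('i, 'a, 'n) atlas =
  charts :: "'i set"
  chart_dom :: "'i \<Rightarrow> 'a set"
  chart_map :: "'i \<Rightarrow> 'a \<Rightarrow> real^'n"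

definition points :: "('i, 'a, 'n::finite) atlas \<Rightarrow> 'a set" where
  "points A = (\<Union>c\<in>charts A. chart_dom A c)"

definition chart_image :: "('i, 'a, 'n::finite) atlas \<Rightarrow> 'i \<Rightarrow> (real^'n) set" where
  "chart_image A c = chart_map A c ` chart_dom A c"

definition overlap :: "('i, 'a, 'n::finite) atlas \<Rightarrow> 'i \<Rightarrow> 'i \<Rightarrow> (real^'n) set" where
  "overlap A c d = chart_map A c ` (chart_dom A c \<inter> chart_dom A d)"

definition transition ::
  "('i, 'a, 'n::finite) atlas \<Rightarrow> 'i \<Rightarrow> 'i \<Rightarrow> real^'n \<Rightarrow> real^'n" where
  "transition A c d = chart_map A d \<circ> inv_into (chart_dom A c) (chart_map A c)"

definition atlas_topology :: "('i, 'a, 'n::finite) atlas \<Rightarrow> 'a topology" where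
  "atlas_topology A = topology_generated_by
     {{q \<in> chart_dom A c. chart_map A c q \<in> W} | c W. c \<in> charts A \<and> open W}"

definition smooth_manifold :: "('i, 'a, 'n::finite) atlas \<Rightarrow> bool" where
  "smooth_manifold A \<longleftrightarrow>
     (\<forall>c\<in>charts A. inj_on (chart_map A c) (chart_dom A c) \<and> open (chart_image A c)) \<and>
     (\<forall>c\<in>charts A. \<forall>d\<in>charts A.
        open (overlap A c d) \<and> smooth_on (overlap A c d) (transition A c d)) \<and>
     Hausdorff_space (atlas_topology A) \<and> second_countable (atlas_topology A)"


section \<open>Tensor fields\<close>

text \<open>
  Tensors are given by their components in every chart, subject to the transformation law.
  Conventions: the matrix \<open>g c x\<close> has entries $g_{ij}$; the matrix \<open>J c x\<close> has entries
  $J^i{}_j$ (row \<open>i\<close>, column \<open>j\<close>), so that it acts on components of vectors by \<open>*v\<close>.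
\<close>

type_synonym ('i, 'n) matrix_field = "'i \<Rightarrow> real^'n \<Rightarrow> real^'n^'n"

definition metric_ip :: "real^'n^'n \<Rightarrow> real^'n \<Rightarrow> real^'n \<Rightarrow> real" where
  "metric_ip G X Y = (G *v X) \<bullet> Y"

definition riemannian_metric ::
  "('i, 'a, 'n::finite) atlas \<Rightarrow> ('i, 'n) matrix_field \<Rightarrow> bool" where
  "riemannian_metric A g \<longleftrightarrow>
     (\<forall>c\<in>charts A. smooth_on (chart_image A c) (g c)) \<and>
     (\<forall>c\<in>charts A. \<forall>x\<in>chart_image A c.
        transpose (g c x) = g c x \<and> (\<forall>X. X \<noteq> 0 \<longrightarrow> metric_ip (g c x) X X > 0)) \<and>
     (\<forall>c\<in>charts A. \<forall>d\<in>charts A. \<forall>x\<in>overlap A c d.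
        let D = jacobian (transition A c d) (at x)
        in g c x = transpose D ** g d (transition A c d x) ** D)"

definition almost_complex_structure ::
  "('i, 'a, 'n::finite) atlas \<Rightarrow> ('i, 'n) matrix_field \<Rightarrow> bool" where
  "almost_complex_structure A J \<longleftrightarrow>
     (\<forall>c\<in>charts A. smooth_on (chart_image A c) (J c)) \<and>
     (\<forall>c\<in>charts A. \<forall>x\<in>chart_image A c. J c x ** J c x = - mat 1) \<and>
     (\<forall>c\<in>charts A. \<forall>d\<in>charts A. \<forall>x\<in>overlap A c d.
        let D = jacobian (transition A c d) (at x)
        in J d (transition A c d x) ** D = D ** J c x)"

text \<open>
  \<open>christoffel G x k i j\<close> is $\Gamma^k_{ij}$ at \<open>x\<close> for the Levi-Civita connection of \<open>G\<close>.
\<close>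

definition christoffel ::
  "(real^'n \<Rightarrow> real^'n^'n) \<Rightarrow> real^'n \<Rightarrow> 'n \<Rightarrow> 'n \<Rightarrow> 'n::finite \<Rightarrow> real" where
  "christoffel G x k i j = 1/2 * (\<Sum>l\<in>UNIV. matrix_inv (G x) $ k $ l *
     (partial_deriv i (\<lambda>y. G y $ j $ l) x + partial_deriv j (\<lambda>y. G y $ i $ l) x
        - partial_deriv l (\<lambda>y. G y $ i $ j) x))"

text \<open>The component $(\nabla_k J)^i{}_j$.\<close>

definition nabla_endo ::
  "(real^'n \<Rightarrow> real^'n^'n) \<Rightarrow> (real^'n \<Rightarrow> real^'n^'n) \<Rightarrow> real^'n \<Rightarrow> 'n \<Rightarrow> 'n \<Rightarrow> 'n::finite \<Rightarrow> real"
  where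
  "nabla_endo G J x k i j = partial_deriv k (\<lambda>y. J y $ i $ j) x
     + (\<Sum>l\<in>UNIV. christoffel G x i k l * J x $ l $ j)
     - (\<Sum>l\<in>UNIV. christoffel G x l k j * J x $ i $ l)"

definition kaehler_manifold ::
  "nat \<Rightarrow> ('i, 'a, 'n::finite) atlas \<Rightarrow> ('i, 'n) matrix_field \<Rightarrow> ('i, 'n) matrix_field \<Rightarrow> bool"
  where
  "kaehler_manifold m A J g \<longleftrightarrow>
     smooth_manifold A \<and> CARD('n) = 2 * m \<and>
     almost_complex_structure A J \<and> riemannian_metric A g \<and>
     (\<forall>c\<in>charts A. \<forall>x\<in>chart_image A c.
        (\<forall>X Y. metric_ip (g c x) (J c x *v X) (J c x *v Y) = metric_ip (g c x) X Y) \<and>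
        (\<forall>k i j. nabla_endo (g c) (J c) x k i j = 0))"


section \<open>Geodesics\<close>

definition smooth_curve ::
  "('i, 'a, 'n::finite) atlas \<Rightarrow> real set \<Rightarrow> (real \<Rightarrow> 'a) \<Rightarrow> bool" where
  "smooth_curve A I \<gamma> \<longleftrightarrow>
     is_interval I \<and> (\<exists>a\<in>I. \<exists>b\<in>I. a < b) \<and> \<gamma> ` I \<subseteq> points A \<and>
     (\<forall>c\<in>charts A.
        openin (top_of_set I) {t \<in> I. \<gamma> t \<in> chart_dom A c} \<and>
        smooth_on {t \<in> I. \<gamma> t \<in> chart_dom A c} (chart_map A c \<circ> \<gamma>))"

definition velocity ::
  "('i, 'a, 'n::finite) atlas \<Rightarrow> real set \<Rightarrow> (real \<Rightarrow> 'a) \<Rightarrow> 'i \<Rightarrow> real \<Rightarrow> real^'n" where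
  "velocity A I \<gamma> c t = vector_derivative (chart_map A c \<circ> \<gamma>) (at t within I)"

text \<open>
  The covariant derivative along \<open>\<gamma>\<close>, in the chart \<open>c\<close>, of a vector field with components \<open>V\<close>
  and of a covector field with components \<open>\<omega>\<close>:
  $(\nabla_{\gamma'}V)^k = dV^k/dt + \Gamma^k_{ij}\,\dot x^i V^j$ and
  $(\nabla_{\gamma'}\omega)_i = d\omega_i/dt - \Gamma^h_{ij}\,\dot x^j\omega_h$.
\<close>

definition cov_deriv_vector ::
  "('i, 'a, 'n::finite) atlas \<Rightarrow> ('i, 'n) matrix_field \<Rightarrow> real set \<Rightarrow> (real \<Rightarrow> 'a) \<Rightarrow> 'i
     \<Rightarrow> (real \<Rightarrow> real^'n) \<Rightarrow> real \<Rightarrow> real^'n" where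
  "cov_deriv_vector A g I \<gamma> c V t = vector_derivative V (at t within I) +
     (\<chi> k. \<Sum>i\<in>UNIV. \<Sum>j\<in>UNIV.
        christoffel (g c) (chart_map A c (\<gamma> t)) k i j * velocity A I \<gamma> c t $ i * V t $ j)"

definition cov_deriv_covector ::
  "('i, 'a, 'n::finite) atlas \<Rightarrow> ('i, 'n) matrix_field \<Rightarrow> real set \<Rightarrow> (real \<Rightarrow> 'a) \<Rightarrow> 'i
     \<Rightarrow> (real \<Rightarrow> real^'n) \<Rightarrow> real \<Rightarrow> real^'n" where
  "cov_deriv_covector A g I \<gamma> c \<omega> t = vector_derivative \<omega> (at t within I) -
     (\<chi> i. \<Sum>h\<in>UNIV. \<Sum>j\<in>UNIV.
        christoffel (g c) (chart_map A c (\<gamma> t)) h i j * velocity A I \<gamma> c t $ j * \<omega> t $ h)"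

definition geodesic ::
  "('i, 'a, 'n::finite) atlas \<Rightarrow> ('i, 'n) matrix_field \<Rightarrow> real set \<Rightarrow> (real \<Rightarrow> 'a) \<Rightarrow> bool" where
  "geodesic A g I \<gamma> \<longleftrightarrow> smooth_curve A I \<gamma> \<and>
     (\<forall>c\<in>charts A. \<forall>t\<in>I. \<gamma> t \<in> chart_dom A c \<longrightarrow>
        cov_deriv_vector A g I \<gamma> c (velocity A I \<gamma> c) t = 0)"


section \<open>The cotangent bundle\<close>

text \<open>
  A covector at \<open>q\<close> is the family of its components in the charts around \<open>q\<close>; at all other
  indices the family is set to \<open>0\<close>, so that distinct families are distinct covectors.
\<close>

definition cotangent_space :: "('i, 'a, 'n::finite) atlas \<Rightarrow> 'a \<Rightarrow> ('i \<Rightarrow> real^'n) set" where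
  "cotangent_space A q = {p.
     (\<forall>c\<in>charts A. \<forall>d\<in>charts A. q \<in> chart_dom A c \<inter> chart_dom A d \<longrightarrow>
        p c = transpose (jacobian (transition A c d) (at (chart_map A c q))) *v p d) \<and>
     (\<forall>c. \<not> (c \<in> charts A \<and> q \<in> chart_dom A c) \<longrightarrow> p c = 0)}"

text \<open>
  Coordinates \<open>(x, p)\<close> on the cotangent bundle live in \<open>real^('n + 'n)\<close>, with \<open>Inl i\<close> the
  index of $x^i$ and \<open>Inr i\<close> the index of $p_i$.
\<close>

definition vec_pair :: "real^'n \<Rightarrow> real^'n \<Rightarrow> real^('n::finite + 'n)" where
  "vec_pair u v = (\<chi> s. case s of Inl i \<Rightarrow> u $ i | Inr i \<Rightarrow> v $ i)"

definition base_part :: "real^('n::finite + 'n) \<Rightarrow> real^'n" where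
  "base_part z = (\<chi> i. z $ Inl i)"

definition fibre_part :: "real^('n::finite + 'n) \<Rightarrow> real^'n" where
  "fibre_part z = (\<chi> i. z $ Inr i)"

definition cotangent_bundle ::
  "('i, 'a, 'n::finite) atlas \<Rightarrow> ('i, 'a \<times> ('i \<Rightarrow> real^'n), 'n + 'n) atlas" where
  "cotangent_bundle A =
     \<lparr> charts = charts A,
       chart_dom = (\<lambda>c. {(q, p). q \<in> chart_dom A c \<and> p \<in> cotangent_space A q}),
       chart_map = (\<lambda>c (q, p). vec_pair (chart_map A c q) (p c)) \<rparr>"

definition hor_lift ::
  "(real^'n \<Rightarrow> real^'n^'n) \<Rightarrow> real^('n::finite + 'n) \<Rightarrow> real^'n \<Rightarrow> real^('n + 'n)" where
  "hor_lift G z X = vec_pair X (\<chi> i. \<Sum>h\<in>UNIV. \<Sum>j\<in>UNIV.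
     fibre_part z $ h * christoffel G (base_part z) h i j * X $ j)"

definition vert_lift :: "real^'n \<Rightarrow> real^('n::finite + 'n)" where
  "vert_lift \<omega> = vec_pair 0 \<omega>"

definition sharp :: "real^'n^'n \<Rightarrow> real^'n \<Rightarrow> real^'n" where
  "sharp G \<omega> = matrix_inv G *v \<omega>"

definition cometric_ip :: "real^'n^'n \<Rightarrow> real^'n \<Rightarrow> real^'n \<Rightarrow> real" where
  "cometric_ip G \<omega> \<theta> = metric_ip G (sharp G \<omega>) (sharp G \<theta>)"

definition covec_comp :: "real^'n \<Rightarrow> real^'n^'n \<Rightarrow> real^'n" where
  "covec_comp \<omega> J = transpose J *v \<omega>"

definition is_berger_sasaki_at ::
  "(real^'n \<Rightarrow> real^'n^'n) \<Rightarrow> (real^'n \<Rightarrow> real^'n^'n) \<Rightarrow> real \<Rightarrow> real^('n::finite + 'n)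
     \<Rightarrow> real^('n + 'n)^('n + 'n) \<Rightarrow> bool" where
  "is_berger_sasaki_at G J \<delta> z B \<longleftrightarrow>
     transpose B = B \<and>
     (\<forall>X Y. metric_ip B (hor_lift G z X) (hor_lift G z Y) = metric_ip (G (base_part z)) X Y) \<and>
     (\<forall>X \<theta>. metric_ip B (hor_lift G z X) (vert_lift \<theta>) = 0) \<and>
     (\<forall>\<omega> \<theta>. metric_ip B (vert_lift \<omega>) (vert_lift \<theta>) =
        (let x = base_part z; pJ = covec_comp (fibre_part z) (J x)
         in cometric_ip (G x) \<omega> \<theta> + \<delta>\<^sup>2 * cometric_ip (G x) \<omega> pJ * cometric_ip (G x) \<theta> pJ))"

text \<open>The component matrix is well defined by \<open>is_berger_sasaki_at_ex1\<close> below.\<close>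

definition berger_sasaki ::
  "('i, 'n) matrix_field \<Rightarrow> ('i, 'n) matrix_field \<Rightarrow> real \<Rightarrow> ('i, 'n::finite + 'n) matrix_field"
  where
  "berger_sasaki g J \<delta> c z = (THE B. is_berger_sasaki_at (g c) (J c) \<delta> z B)"

text \<open>
  \<open>horizontal_lift A g I \<gamma> C\<close>: the curve \<open>C = (\<gamma>, \<theta>)\<close> in the cotangent bundle consists of
  \<open>\<gamma>\<close> and a smooth parallel covector field \<open>\<theta>\<close> along \<open>\<gamma>\<close>.
\<close>

definition covector_field_along ::
  "('i, 'a, 'n::finite) atlas \<Rightarrow> real set \<Rightarrow> (real \<Rightarrow> 'a) \<Rightarrow> (real \<Rightarrow> 'i \<Rightarrow> real^'n) \<Rightarrow> bool" where
  "covector_field_along A I \<gamma> \<theta> \<longleftrightarrow>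
     (\<forall>t\<in>I. \<theta> t \<in> cotangent_space A (\<gamma> t)) \<and>
     (\<forall>c\<in>charts A. smooth_on {t \<in> I. \<gamma> t \<in> chart_dom A c} (\<lambda>t. \<theta> t c))"

definition horizontal_lift ::
  "('i, 'a, 'n::finite) atlas \<Rightarrow> ('i, 'n) matrix_field \<Rightarrow> real set \<Rightarrow> (real \<Rightarrow> 'a)
     \<Rightarrow> (real \<Rightarrow> 'a \<times> ('i \<Rightarrow> real^'n)) \<Rightarrow> bool" where
  "horizontal_lift A g I \<gamma> C \<longleftrightarrow>
     (\<exists>\<theta>. (\<forall>t\<in>I. C t = (\<gamma> t, \<theta> t)) \<and> covector_field_along A I \<gamma> \<theta> \<and>
        (\<forall>c\<in>charts A. \<forall>t\<in>I. \<gamma> t \<in> chart_dom A c \<longrightarrow>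
           cov_deriv_covector A g I \<gamma> c (\<lambda>s. \<theta> s c) t = 0))"


section \<open>Well-definedness of the Berger-type deformed Sasaki metric\<close>

lemma metric_ip_add_left: "metric_ip G (X + Y) Z = metric_ip G X Z + metric_ip G Y Z"
  by (simp add: metric_ip_def matrix_vector_right_distrib inner_add_left)

lemma metric_ip_add_right: "metric_ip G Z (X + Y) = metric_ip G Z X + metric_ip G Z Y"
  by (simp add: metric_ip_def inner_add_right)

lemma metric_ip_scale_left: "metric_ip G (r *\<^sub>R X) Z = r * metric_ip G X Z"
  by (simp add: metric_ip_def matrix_vector_mult_scaleR)

lemma metric_ip_scale_right: "metric_ip G Z (r *\<^sub>R X) = r * metric_ip G Z X"
  by (simp add: metric_ip_def)

lemma metric_ip_sym: "transpose G = G \<Longrightarrow> metric_ip G X Y = metric_ip G Y X"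
  by (metis metric_ip_def dot_lmul_matrix inner_commute transpose_matrix_vector)

lemma metric_ip_posdef_invertible:
  assumes "\<And>X. X \<noteq> 0 \<Longrightarrow> metric_ip G X X > 0"
  shows "invertible (G :: real^'n^'n)"
proof -
  have "X = 0" if "G *v X = 0" for X
    using assms[of X] that by (force simp: metric_ip_def)
  thus ?thesis
    using invertible_left_inverse matrix_left_invertible_ker by blast
qed

lemma matrix_inv_mult:
  fixes G :: "real^'n^'n"
  assumes "invertible G"
  shows "G ** matrix_inv G = mat 1" "matrix_inv G ** G = mat 1"
  using someI_ex[OF assms[unfolded invertible_def]] by (auto simp: matrix_inv_def)

lemma metric_ip_sharp:
  assumes "invertible (G :: real^'n^'n)"
  shows "metric_ip G (sharp G \<omega>) X = \<omega> \<bullet> X"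
  by (simp add: metric_ip_def sharp_def matrix_vector_mul_assoc matrix_inv_mult[OF assms])

lemma covec_comp_inner: "covec_comp \<omega> J \<bullet> X = \<omega> \<bullet> (J *v X)"
  by (simp add: covec_comp_def dot_lmul_matrix)

lemma vec_pair_sel [simp]:
  "base_part (vec_pair u v) = u" "fibre_part (vec_pair u v) = v"
  "vec_pair (base_part z) (fibre_part z) = z"
  by (auto simp: vec_pair_def base_part_def fibre_part_def vec_eq_iff split: sum.splits)

lemma part_linear:
  "base_part (z + w) = base_part z + base_part w"
  "fibre_part (z + w) = fibre_part z + fibre_part w"
  "base_part (r *\<^sub>R z) = r *\<^sub>R base_part z"
  "fibre_part (r *\<^sub>R z) = r *\<^sub>R fibre_part z"
  by (auto simp: base_part_def fibre_part_def vec_eq_iff)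

lemma vec_pair_linear:
  "vec_pair (u + u') (v + v') = vec_pair u v + vec_pair u' v'"
  "vec_pair (r *\<^sub>R u) (r *\<^sub>R v) = r *\<^sub>R vec_pair u v"
  by (auto simp: vec_pair_def vec_eq_iff split: sum.splits)

text \<open>Every tangent vector of the cotangent bundle is a horizontal plus a vertical lift.\<close>

definition vert_part ::
  "(real^'n \<Rightarrow> real^'n^'n) \<Rightarrow> real^('n::finite + 'n) \<Rightarrow> real^('n + 'n) \<Rightarrow> real^'n" where
  "vert_part G z W = fibre_part W - fibre_part (hor_lift G z (base_part W))"

lemma lift_decomposition: "W = hor_lift G z (base_part W) + vert_lift (vert_part G z W)"
proof -
  have "hor_lift G z (base_part W) =
      vec_pair (base_part W) (fibre_part (hor_lift G z (base_part W)))"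
    by (simp add: hor_lift_def)
  hence "hor_lift G z (base_part W) + vert_lift (vert_part G z W) =
      vec_pair (base_part W + 0)
        (fibre_part (hor_lift G z (base_part W)) + vert_part G z W)"
    unfolding vert_lift_def vec_pair_linear(1) by simp
  thus ?thesis by (simp add: vert_part_def)
qed

lemma hor_lift_linear:
  "hor_lift G z (X + Y) = hor_lift G z X + hor_lift G z Y"
  "hor_lift G z (r *\<^sub>R X) = r *\<^sub>R hor_lift G z X"
proof -
  have "(\<chi> i. \<Sum>h\<in>UNIV. \<Sum>j\<in>UNIV.
          fibre_part z $ h * christoffel G (base_part z) h i j * (X + Y) $ j) =
        (\<chi> i. \<Sum>h\<in>UNIV. \<Sum>j\<in>UNIV.
          fibre_part z $ h * christoffel G (base_part z) h i j * X $ j) +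
        (\<chi> i. \<Sum>h\<in>UNIV. \<Sum>j\<in>UNIV.
          fibre_part z $ h * christoffel G (base_part z) h i j * Y $ j)"
    by (simp add: vec_eq_iff algebra_simps sum.distrib)
  thus "hor_lift G z (X + Y) = hor_lift G z X + hor_lift G z Y"
    unfolding hor_lift_def vec_pair_linear(1)[symmetric] by simp
  have "(\<chi> i. \<Sum>h\<in>UNIV. \<Sum>j\<in>UNIV.
          fibre_part z $ h * christoffel G (base_part z) h i j * (r *\<^sub>R X) $ j) =
        r *\<^sub>R (\<chi> i. \<Sum>h\<in>UNIV. \<Sum>j\<in>UNIV.
          fibre_part z $ h * christoffel G (base_part z) h i j * X $ j)"
    by (simp add: vec_eq_iff algebra_simps sum_distrib_left)
  thus "hor_lift G z (r *\<^sub>R X) = r *\<^sub>R hor_lift G z X"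
    unfolding hor_lift_def vec_pair_linear(2)[symmetric] by simp
qed

lemma vert_part_linear:
  "vert_part G z (W + W') = vert_part G z W + vert_part G z W'"
  "vert_part G z (r *\<^sub>R W) = r *\<^sub>R vert_part G z W"
  by (simp_all add: vert_part_def part_linear hor_lift_linear algebra_simps)

lemma lift_parts [simp]:
  "base_part (hor_lift G z X) = X" "vert_part G z (hor_lift G z X) = 0"
  "base_part (vert_lift \<omega>) = 0" "vert_part G z (vert_lift \<omega>) = \<omega>"
proof -
  show *: "base_part (hor_lift G z X) = X" by (simp add: hor_lift_def)
  show "vert_part G z (hor_lift G z X) = 0" by (simp add: vert_part_def *)
  show **: "base_part (vert_lift \<omega>) = 0" by (simp add: vert_lift_def)
  have "hor_lift G z 0 = 0" using hor_lift_linear(2)[of G z 0 0] by simp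
  moreover have "fibre_part 0 = 0" by (simp add: fibre_part_def vec_eq_iff)
  ultimately show "vert_part G z (vert_lift \<omega>) = \<omega>"
    by (simp add: vert_part_def **) (simp add: vert_lift_def)
qed

lemma bilinear_matrix:
  fixes b :: "real^'n \<Rightarrow> real^'n \<Rightarrow> real"
  assumes "bilinear b"
  shows "metric_ip (\<chi> i j. b (axis j 1) (axis i 1)) X Y = b X Y"
proof -
  have "b X Y = b (\<Sum>j\<in>UNIV. X $ j *\<^sub>R axis j 1) (\<Sum>i\<in>UNIV. Y $ i *\<^sub>R axis i 1)"
    by (metis (no_types, lifting) basis_expansion scalar_mult_eq_scaleR sum.cong)
  also have "\<dots> = (\<Sum>(j, i)\<in>UNIV \<times> UNIV. b (X $ j *\<^sub>R axis j 1) (Y $ i *\<^sub>R axis i 1))"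
    by (rule bilinear_sum[OF assms])
  also have "\<dots> = (\<Sum>j\<in>UNIV. \<Sum>i\<in>UNIV. X $ j * (Y $ i * b (axis j 1) (axis i 1)))"
    unfolding UNIV_Times_UNIV[symmetric] sum.cartesian_product[symmetric]
    by (simp add: bilinear_lmul[OF assms] bilinear_rmul[OF assms] algebra_simps)
  also have "\<dots> = (\<Sum>i\<in>UNIV. \<Sum>j\<in>UNIV. X $ j * (Y $ i * b (axis j 1) (axis i 1)))"
    by (rule sum.swap)
  also have "\<dots> = metric_ip (\<chi> i j. b (axis j 1) (axis i 1)) X Y"
    by (simp add: metric_ip_def matrix_vector_mult_def inner_vec_def sum_distrib_left
        sum_distrib_right mult_ac)
  finally show ?thesis ..
qed

lemma metric_ip_eqI: "(\<And>X Y. metric_ip G X Y = metric_ip H X Y) \<Longrightarrow> G = (H :: real^'n^'n)"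
  unfolding metric_ip_def by (metis matrix_eq vector_eq_rdot)

lemma is_berger_sasaki_at_ip:
  assumes "is_berger_sasaki_at G J \<delta> z B"
  defines "x \<equiv> base_part z"
  defines "pJ \<equiv> covec_comp (fibre_part z) (J x)"
  shows "metric_ip B W W' = metric_ip (G x) (base_part W) (base_part W')
     + cometric_ip (G x) (vert_part G z W) (vert_part G z W')
     + \<delta>\<^sup>2 * cometric_ip (G x) (vert_part G z W) pJ * cometric_ip (G x) (vert_part G z W') pJ"
proof -
  have sym: "transpose B = B" using assms(1) by (simp add: is_berger_sasaki_at_def)
  have HV: "metric_ip B (hor_lift G z X) (vert_lift \<theta>) = 0" for X \<theta>
    using assms(1) by (simp add: is_berger_sasaki_at_def)
  hence VH: "metric_ip B (vert_lift \<theta>) (hor_lift G z X) = 0" for X \<theta>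
    using metric_ip_sym[OF sym] by metis
  have "metric_ip B W W' = metric_ip B
      (hor_lift G z (base_part W) + vert_lift (vert_part G z W))
      (hor_lift G z (base_part W') + vert_lift (vert_part G z W'))"
    using lift_decomposition by metis
  thus ?thesis
    using assms(1) HV VH
    by (simp add: metric_ip_add_left metric_ip_add_right is_berger_sasaki_at_def Let_def
        x_def pJ_def)
qed

lemma is_berger_sasaki_at_ex1:
  assumes sym: "transpose (G (base_part z)) = G (base_part z)"
  shows "\<exists>!B. is_berger_sasaki_at G J \<delta> z B"
proof (rule ex_ex1I)
  define x where "x = base_part z"
  define pJ where "pJ = covec_comp (fibre_part z) (J x)"
  define b where "b = (\<lambda>W W'. metric_ip (G x) (base_part W) (base_part W')
     + cometric_ip (G x) (vert_part G z W) (vert_part G z W')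
     + \<delta>\<^sup>2 * cometric_ip (G x) (vert_part G z W) pJ * cometric_ip (G x) (vert_part G z W') pJ)"
  have co_lin: "cometric_ip (G x) (u + v) w = cometric_ip (G x) u w + cometric_ip (G x) v w"
    "cometric_ip (G x) w (u + v) = cometric_ip (G x) w u + cometric_ip (G x) w v"
    "cometric_ip (G x) (r *\<^sub>R u) w = r * cometric_ip (G x) u w"
    "cometric_ip (G x) w (r *\<^sub>R u) = r * cometric_ip (G x) w u" for u v w r
    by (simp_all add: cometric_ip_def sharp_def matrix_vector_right_distrib
        matrix_vector_mult_scaleR metric_ip_add_left metric_ip_add_right
        metric_ip_scale_left metric_ip_scale_right)
  have bil: "bilinear b"
    unfolding bilinear_def b_def
    by (intro conjI allI linearI)
      (simp_all add: part_linear vert_part_linear co_lin metric_ip_add_left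
        metric_ip_add_right metric_ip_scale_left metric_ip_scale_right algebra_simps)
  have bsym: "b W W' = b W' W" for W W'
    using metric_ip_sym[of "G x"] sym by (simp add: b_def cometric_ip_def x_def mult_ac)
  define B where "B = (\<chi> i j. b (axis j 1) (axis i 1))"
  have B: "metric_ip B W W' = b W W'" for W W'
    unfolding B_def by (rule bilinear_matrix[OF bil])
  have "transpose B = B"
    by (simp add: B_def transpose_def vec_eq_iff bsym)
  moreover have "cometric_ip (G x) 0 w = 0" "cometric_ip (G x) w 0 = 0"
    "metric_ip (G x) 0 w = 0" "metric_ip (G x) w 0 = 0" for w
    by (simp_all add: cometric_ip_def sharp_def metric_ip_def)
  ultimately show "\<exists>B. is_berger_sasaki_at G J \<delta> z B"
    by (intro exI[of _ B])
      (simp add: is_berger_sasaki_at_def B, simp add: b_def Let_def pJ_def x_def)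
next
  show "B = B'" if "is_berger_sasaki_at G J \<delta> z B" "is_berger_sasaki_at G J \<delta> z B'" for B B'
    using is_berger_sasaki_at_ip[OF that(1)] is_berger_sasaki_at_ip[OF that(2)]
    by (intro metric_ip_eqI) simp
qed

lemma berger_sasaki_spec:
  assumes "riemannian_metric A g" "c \<in> charts A" "base_part z \<in> chart_image A c"
  shows "is_berger_sasaki_at (g c) (J c) \<delta> z (berger_sasaki g J \<delta> c z)"
proof -
  have "transpose (g c (base_part z)) = g c (base_part z)"
    using assms by (simp add: riemannian_metric_def)
  thus ?thesis
    unfolding berger_sasaki_def by (rule theI'[OF is_berger_sasaki_at_ex1])
qed

lemma berger_sasaki_pos:
  assumes A: "riemannian_metric A g" "c \<in> charts A" "base_part z \<in> chart_image A c"
    and W: "W \<noteq> 0"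
  shows "metric_ip (berger_sasaki g J \<delta> c z) W W > 0"
proof -
  let ?G = "g c (base_part z)"
  have pos: "metric_ip ?G X X > 0" if "X \<noteq> 0" for X
    using A that by (simp add: riemannian_metric_def)
  hence nonneg: "metric_ip ?G X X \<ge> 0" for X
    by (cases "X = 0") (auto simp: metric_ip_def less_imp_le)
  have inv: "invertible ?G" using metric_ip_posdef_invertible pos by blast
  have sharp0: "\<omega> = 0" if "sharp ?G \<omega> = 0" for \<omega>
    using metric_ip_sharp[OF inv, of \<omega> \<omega>] that by (simp add: metric_ip_def)
  let ?q = "vert_part (g c) z W"
  have "base_part W \<noteq> 0 \<or> ?q \<noteq> 0"
  proof (rule ccontr)
    assume "\<not> ?thesis"
    hence "W = hor_lift (g c) z 0 + vert_lift 0" using lift_decomposition by metis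
    also have "\<dots> = 0"
      using hor_lift_linear(2)[of "g c" z 0 0] vec_pair_linear(2)[of 0 0 0]
      by (simp add: vert_lift_def)
    finally show False using W by simp
  qed
  hence "metric_ip ?G (base_part W) (base_part W) + cometric_ip ?G ?q ?q > 0"
    using pos nonneg sharp0 unfolding cometric_ip_def
    by (metis add_nonneg_pos add_pos_nonneg)
  moreover have "\<delta>\<^sup>2 * r * r \<ge> 0" for r :: real
    by (simp add: mult.assoc)
  ultimately show ?thesis
    by (simp add: is_berger_sasaki_at_ip[OF berger_sasaki_spec[OF A]] add_pos_nonneg)
qed

end

theory Submission
  imports Defs
begin

text \<open>
  In a chart, lowering the index of the geodesic equation of a metric \<open>B\<close> for a curve \<open>z\<close> turns it
  into $\frac{d}{dt} B(z', Y) = \frac12 (D_Y B)(z', z')$ for all constant \<open>Y\<close>. Parallelism of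
  the covector field says that \<open>z'\<close> is the horizontal lift of the velocity of the base curve. Hence
  $B(z', Y)$ is the corresponding product on the base, and the right-hand side is that of the base
  as well: the deformed metric exceeds the base metric by a nonnegative function of the vertical
  part, which has a minimum, hence zero derivative, where the vertical part vanishes.
\<close>

section \<open>Christoffel symbols and the geodesic equation with lowered index\<close>

lemma has_derivative_partial_deriv:
  assumes "(B has_derivative B') (at z)"
  shows "partial_deriv i (\<lambda>y. B y $ j $ l) z = B' (axis i 1) $ j $ (l :: 'm::finite)"
proof -
  have "((\<lambda>y. B y $ j $ l) has_derivative (\<lambda>v. B' v $ j $ l)) (at z)"
    by (intro bounded_linear.has_derivative[OF bounded_linear_vec_nth] assms)
  from frechet_derivative_at[OF this] show ?thesis
    by (simp add: partial_deriv_def fun_eq_iff)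
qed

text \<open>Multiplying by \<open>B z\<close> cancels the inverse matrix in
  \<open>christoffel\<close>. Contracted twice with \<open>u\<close>, the two positive terms of the
  Christoffel formula agree and add up to one full directional derivative, while the negative term
  keeps its factor 1/2. \<open>Y\<close> is paired with the column index \<open>l\<close>, hence its
  left slot in \<open>metric_ip (B' u) Y u\<close>.\<close>

lemma metric_ip_christoffel:
  fixes B :: "real^'n \<Rightarrow> real^'n^'n"
  assumes B': "(B has_derivative B') (at z)" and inv: "invertible (B z)"
  shows "metric_ip (B z) (\<chi> k. \<Sum>i\<in>UNIV. \<Sum>j\<in>UNIV. christoffel B z k i j * u $ i * u $ j) Y =
    metric_ip (B' u) Y u - 1/2 * metric_ip (B' Y) u u"
proof -
  define b where "b i j l = B' (axis i 1) $ j $ l" for i j l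
  define H where "H = matrix_inv (B z)"
  \<comment> \<open>This is the lowered contraction of \<open>christoffel\<close> with
    \<open>u\<close> and \<open>u\<close>, its two positive terms already merged; the vector to be
    tested against \<open>Y\<close> is therefore \<open>H *v w\<close>.\<close>
  define w where "w = (\<chi> l. \<Sum>i\<in>UNIV. \<Sum>j\<in>UNIV. (b i j l - 1/2 * b l i j) * u $ i * u $ j)"
  interpret B': linear B' using B' by (rule has_derivative_linear)
  have B'_ip: "metric_ip (B' v) X W = (\<Sum>i\<in>UNIV. \<Sum>j\<in>UNIV. \<Sum>l\<in>UNIV. b i j l * v $ i * X $ l * W $ j)"
    for v X W
  proof -
    have "B' v = B' (\<Sum>i\<in>UNIV. v $ i *\<^sub>R axis i 1)"
      by (metis (no_types, lifting) basis_expansion scalar_mult_eq_scaleR sum.cong)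
    also have "\<dots> = (\<Sum>i\<in>UNIV. v $ i *\<^sub>R B' (axis i 1))"
      by (simp add: B'.sum B'.scale)
    finally have "B' v $ j $ l = (\<Sum>i\<in>UNIV. v $ i * b i j l)" for j l
      by (simp add: b_def)
    then have "metric_ip (B' v) X W = (\<Sum>j\<in>UNIV. \<Sum>l\<in>UNIV. \<Sum>i\<in>UNIV. b i j l * v $ i * X $ l * W $ j)"
      by (simp add: metric_ip_def matrix_vector_mult_def inner_vec_def sum_distrib_left
          sum_distrib_right mult_ac)
    also have "\<dots> = (\<Sum>j\<in>UNIV. \<Sum>i\<in>UNIV. \<Sum>l\<in>UNIV. b i j l * v $ i * X $ l * W $ j)"
      by (intro sum.cong refl sum.swap)
    also have "\<dots> = (\<Sum>i\<in>UNIV. \<Sum>j\<in>UNIV. \<Sum>l\<in>UNIV. b i j l * v $ i * X $ l * W $ j)"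
      by (rule sum.swap)
    finally show ?thesis .
  qed
  have "(\<Sum>i\<in>UNIV. \<Sum>j\<in>UNIV. christoffel B z k i j * u $ i * u $ j) = (H *v w) $ k" for k
  proof -
    \<comment> \<open>The product of two components of \<open>u\<close> is symmetric in
      \<open>i\<close> and \<open>j\<close>, so renaming the summation indices identifies the two
      positive Christoffel terms.\<close>
    have swap: "(\<Sum>i\<in>UNIV. \<Sum>j\<in>UNIV. b j i l * u $ i * u $ j) = (\<Sum>i\<in>UNIV. \<Sum>j\<in>UNIV. b i j l * u $ i * u $ j)"
      for l by (subst sum.swap) (simp add: mult_ac)
    have w: "w $ l = (\<Sum>i\<in>UNIV. \<Sum>j\<in>UNIV. 1/2 * (b i j l + b j i l - b l i j) * u $ i * u $ j)" for l
    proof -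
      have "(\<Sum>i\<in>UNIV. \<Sum>j\<in>UNIV. 1/2 * (b i j l + b j i l - b l i j) * u $ i * u $ j) =
         1/2 * ((\<Sum>i\<in>UNIV. \<Sum>j\<in>UNIV. b i j l * u $ i * u $ j) + (\<Sum>i\<in>UNIV. \<Sum>j\<in>UNIV. b j i l * u $ i * u $ j)
           - (\<Sum>i\<in>UNIV. \<Sum>j\<in>UNIV. b l i j * u $ i * u $ j))"
        by (simp add: sum_distrib_left algebra_simps sum.distrib sum_subtractf sum_divide_distrib add_divide_distrib diff_divide_distrib)
      then show ?thesis
        unfolding swap
        by (simp add: w_def sum_distrib_left algebra_simps sum.distrib sum_subtractf sum_divide_distrib)
    qed
    have "(\<Sum>i\<in>UNIV. \<Sum>j\<in>UNIV. christoffel B z k i j * u $ i * u $ j) =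
        (\<Sum>i\<in>UNIV. \<Sum>j\<in>UNIV. \<Sum>l\<in>UNIV. H $ k $ l * (1/2 * (b i j l + b j i l - b l i j) * u $ i * u $ j))"
      unfolding christoffel_def has_derivative_partial_deriv[OF B'] b_def[symmetric] H_def[symmetric]
      by (simp add: sum_distrib_left sum_distrib_right algebra_simps)
    also have "\<dots> = (\<Sum>i\<in>UNIV. \<Sum>l\<in>UNIV. \<Sum>j\<in>UNIV. H $ k $ l * (1/2 * (b i j l + b j i l - b l i j) * u $ i * u $ j))"
      by (intro sum.cong refl sum.swap)
    also have "\<dots> = (\<Sum>l\<in>UNIV. \<Sum>i\<in>UNIV. \<Sum>j\<in>UNIV. H $ k $ l * (1/2 * (b i j l + b j i l - b l i j) * u $ i * u $ j))"
      by (rule sum.swap)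
    also have "\<dots> = (H *v w) $ k"
      by (simp only: w matrix_vector_mult_def vec_lambda_beta sum_distrib_left)
    finally show ?thesis .
  qed
  then have "metric_ip (B z) (\<chi> k. \<Sum>i\<in>UNIV. \<Sum>j\<in>UNIV. christoffel B z k i j * u $ i * u $ j) Y = w \<bullet> Y"
    using matrix_inv_mult(1)[OF inv]
    by (simp add: metric_ip_def matrix_vector_mul_assoc H_def)
  also have "\<dots> = (\<Sum>l\<in>UNIV. \<Sum>i\<in>UNIV. \<Sum>j\<in>UNIV. b i j l * u $ i * Y $ l * u $ j)
      - 1/2 * (\<Sum>l\<in>UNIV. \<Sum>i\<in>UNIV. \<Sum>j\<in>UNIV. b l i j * Y $ l * u $ j * u $ i)"
    by (simp add: w_def inner_vec_def sum_distrib_left sum_distrib_right algebra_simps sum.distrib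
        sum_subtractf sum_divide_distrib)
  also have "(\<Sum>l\<in>UNIV. \<Sum>i\<in>UNIV. \<Sum>j\<in>UNIV. b i j l * u $ i * Y $ l * u $ j) = metric_ip (B' u) Y u"
    unfolding B'_ip by (rule trans[OF sum.swap sum.cong[OF refl sum.swap]])
  finally show ?thesis by (simp add: B'_ip)
qed

lemma bounded_bilinear_matrix_vector_mult:
  "bounded_bilinear ((*v) :: real^'n^'m \<Rightarrow> real^'n \<Rightarrow> real^'m)"
  by (rule bilinear_conv_bounded_bilinear[THEN iffD1])
    (auto simp: bilinear_def algebra_simps matrix_vector_mult_add_rdistrib matrix_vector_right_distrib
        matrix_vector_mult_scaleR scaleR_matrix_vector_assoc intro!: linearI)

lemma has_vector_derivative_metric_ip:
  assumes "(M has_derivative M') (at (x t))" "(x has_vector_derivative u) (at t within S)"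
    and "(V has_vector_derivative a) (at t within S)"
  shows "((\<lambda>s. metric_ip (M (x s)) Y (V s)) has_vector_derivative
    metric_ip (M' u) Y (V t) + metric_ip (M (x t)) Y a) (at t within S)"
proof -
  have "((\<lambda>s. M (x s)) has_vector_derivative M' u) (at t within S)"
    using vector_derivative_diff_chain_within[OF assms(2) has_derivative_at_withinI[OF assms(1)]]
    by (simp add: o_def)
  then have "((\<lambda>s. M (x s) *v Y) has_vector_derivative M' u *v Y) (at t within S)"
    by (rule bounded_linear.has_vector_derivative[OF bounded_bilinear.bounded_linear_left[OF bounded_bilinear_matrix_vector_mult]])
  from bounded_bilinear.has_vector_derivative[OF bounded_bilinear_inner this assms(3)]
  show ?thesis by (simp add: metric_ip_def add.commute)
qed

text \<open>With \<open>u\<close> the velocity, the term \<open>metric_ip (G' u) Y u\<close> of the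
  lowered Christoffel contraction is also what the product rule gives for the change of the metric
  along the curve, so only half the derivative in direction \<open>Y\<close> is left over. The
  covariant derivative stays in the formula as a term: on the base it is known to vanish, on the
  cotangent bundle it is the unknown to be solved for.\<close>

lemma has_vector_derivative_metric_ip_velocity:
  fixes A :: "('i, 'a, 'n::finite) atlas"
  defines "x \<equiv> \<lambda>c \<gamma>. chart_map A c \<circ> \<gamma>"
  assumes G': "(g c has_derivative G') (at (x c \<gamma> t))"
    and G: "invertible (g c (x c \<gamma> t))" "transpose (g c (x c \<gamma> t)) = g c (x c \<gamma> t)"
    and lim: "at t within I \<noteq> bot"
    and x': "x c \<gamma> differentiable (at t within I)"
    and V': "velocity A I \<gamma> c differentiable (at t within I)"
  shows "((\<lambda>s. metric_ip (g c (x c \<gamma> s)) Y (velocity A I \<gamma> c s)) has_vector_derivative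
    metric_ip (g c (x c \<gamma> t)) (cov_deriv_vector A g I \<gamma> c (velocity A I \<gamma> c) t) Y
      + 1/2 * metric_ip (G' Y) (velocity A I \<gamma> c t) (velocity A I \<gamma> c t)) (at t within I)"
proof -
  let ?V = "velocity A I \<gamma> c"
  have 1: "(x c \<gamma> has_vector_derivative ?V t) (at t within I)"
    using x' by (simp add: velocity_def x_def vector_derivative_works)
  have 2: "(?V has_vector_derivative vector_derivative ?V (at t within I)) (at t within I)"
    using V' by (simp add: vector_derivative_works)
  have "metric_ip (g c (x c \<gamma> t)) (cov_deriv_vector A g I \<gamma> c ?V t) Y
      + 1/2 * metric_ip (G' Y) (?V t) (?V t)
    = metric_ip (G' (?V t)) Y (?V t) + metric_ip (g c (x c \<gamma> t)) Y (vector_derivative ?V (at t within I))"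
    using metric_ip_christoffel[OF G' G(1), of "?V t" Y]
      metric_ip_sym[OF G(2), of "vector_derivative ?V (at t within I)" Y]
    by (simp add: cov_deriv_vector_def metric_ip_add_left x_def)
  with has_vector_derivative_metric_ip[OF G' 1 2, of Y] show ?thesis by simp
qed

section \<open>Differentiability of inverse matrices, Christoffel symbols and the deformed
  metric\<close>

lemma differentiable_vec_nth:
  "f differentiable F \<Longrightarrow> (\<lambda>x. f x $ i) differentiable F"
  unfolding differentiable_def using bounded_linear.has_derivative[OF bounded_linear_vec_nth] by blast

text \<open>Components lie in a Euclidean space rather than in the reals, so two applications reduce
  a matrix to its entries.\<close>

lemma differentiable_vecI:
  fixes f :: "'b::real_normed_vector \<Rightarrow> 'c::euclidean_space^'n"
  assumes "\<And>i. (\<lambda>x. f x $ i) differentiable (at x within S)"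
  shows "f differentiable (at x within S)"
  unfolding differentiable_componentwise_within[of f]
proof
  fix b :: "'c^'n" assume "b \<in> Basis"
  then obtain i u where "b = axis i u" by (auto simp: Basis_vec_def)
  then show "(\<lambda>x. f x \<bullet> b) differentiable (at x within S)"
    using assms[of i] by (auto simp: inner_axis differentiable_componentwise_within[of "\<lambda>x. f x $ i"]
       intro: differentiable_inner)
qed

lemma differentiable_matrix_vector_mult:
  fixes M :: "'b::real_normed_vector \<Rightarrow> real^'n^'m"
  shows "M differentiable (at x within S) \<Longrightarrow> u differentiable (at x within S) \<Longrightarrow>
    (\<lambda>x. M x *v u x) differentiable (at x within S)"
  unfolding differentiable_def
  using bounded_bilinear.FDERIV[OF bounded_bilinear_matrix_vector_mult] by blast

lemma differentiable_transpose:
  fixes M :: "'b::real_normed_vector \<Rightarrow> real^'n^'m"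
  shows "M differentiable (at x within S) \<Longrightarrow> (\<lambda>x. transpose (M x)) differentiable (at x within S)"
  by (intro differentiable_vecI) (simp add: transpose_def differentiable_vec_nth)

lemma differentiable_prod:
  fixes f :: "'i \<Rightarrow> 'b::real_normed_vector \<Rightarrow> real"
  shows "(\<And>i. i \<in> K \<Longrightarrow> f i differentiable (at x within S)) \<Longrightarrow>
    (\<lambda>x. \<Prod>i\<in>K. f i x) differentiable (at x within S)"
  unfolding differentiable_def using has_derivative_prod[of K f _ x S] by metis

lemma differentiable_det:
  fixes M :: "'b::real_normed_vector \<Rightarrow> real^'n^'n"
  assumes "\<And>i j. (\<lambda>x. M x $ i $ j) differentiable (at x within S)"
  shows "(\<lambda>x. det (M x)) differentiable (at x within S)"
  unfolding det_def
  by (intro differentiable_sum ballI differentiable_mult differentiable_prod assms)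
    (auto simp: finite_permutations)

lemma differentiable_metric_ip:
  fixes M :: "'b::real_normed_vector \<Rightarrow> real^'n^'n"
  assumes "M differentiable (at x within S)" "u differentiable (at x within S)"
    "v differentiable (at x within S)"
  shows "(\<lambda>x. metric_ip (M x) (u x) (v x)) differentiable (at x within S)"
  unfolding metric_ip_def using assms by (intro differentiable_inner differentiable_matrix_vector_mult)

text \<open>Column \<open>l\<close> of the inverse solves the linear system with right-hand side
  \<open>axis l 1\<close>, and Cramer's rule solves it. The quotient of determinants makes the
  dependence on the entries of \<open>M\<close> explicit.\<close>

lemma matrix_inv_cramer:
  fixes M :: "real^'n^'n"
  assumes "invertible M"
  shows "matrix_inv M $ k $ l = det (\<chi> i j. if j = k then axis l 1 $ i else M $ i $ j) / det M"
proof -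
  have "M *v (matrix_inv M *v axis l 1) = axis l 1"
    using matrix_inv_mult(1)[OF assms] by (simp add: matrix_vector_mul_assoc)
  moreover have "det M \<noteq> 0" using assms by (simp add: invertible_det_nz)
  ultimately have "matrix_inv M *v axis l 1 =
      (\<chi> k. det (\<chi> i j. if j = k then axis l 1 $ i else M $ i $ j) / det M)"
    using cramer by blast
  moreover have "(matrix_inv M *v axis l 1) $ k = matrix_inv M $ k $ l"
    by (simp add: matrix_vector_mul_component inner_axis)
  ultimately show ?thesis by simp
qed

lemma differentiable_transform_open:
  assumes "f differentiable (at x)" "open S" "x \<in> S" "\<And>y. y \<in> S \<Longrightarrow> f y = h y"
  shows "h differentiable (at x)"
  using assms unfolding differentiable_def by (blast intro: has_derivative_transform_within_open)

text \<open>By Cramer's rule the entries of the inverse are rational functions of those of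
  \<open>G\<close>. The formula holds only where \<open>G\<close> is invertible, so it is used on
  the neighbourhood \<open>S\<close> of \<open>x\<close>.\<close>

lemma differentiable_matrix_inv:
  fixes G :: "'b::real_normed_vector \<Rightarrow> real^'n^'n"
  assumes G: "G differentiable (at x)" and S: "open S" "x \<in> S"
    and inv: "\<And>y. y \<in> S \<Longrightarrow> invertible (G y)"
  shows "(\<lambda>y. matrix_inv (G y)) differentiable (at x)"
proof (intro differentiable_vecI)
  fix k l
  have nz: "det (G x) \<noteq> 0" using inv[OF S(2)] by (simp add: invertible_det_nz)
  have entry: "(\<lambda>y. if j = k then axis l 1 $ i else G y $ i $ j) differentiable (at x)" for i j
    by (cases "j = k") (simp_all add: differentiable_vec_nth G)
  have "(\<lambda>y. det (\<chi> i j. if j = k then axis l 1 $ i else G y $ i $ j) / det (G y)) differentiable (at x)"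
    by (intro differentiable_divide differentiable_det nz differentiable_vec_nth[OF differentiable_vec_nth[OF G]])
       (simp add: entry)
  then show "(\<lambda>y. matrix_inv (G y) $ k $ l) differentiable (at x)"
    by (rule differentiable_transform_open[OF _ S]) (simp add: matrix_inv_cramer inv)
qed

lemma smooth_on_differentiable:
  assumes "smooth_on S f" "x \<in> S"
  shows "f differentiable (at x within S)"
  using assms(1)[unfolded smooth_on_def, rule_format, of 1] assms(2)
  by (auto simp: differentiable_on_def)

lemma smooth_on_frechet_derivative:
  assumes "smooth_on S f"
  shows "smooth_on S (\<lambda>x. frechet_derivative f (at x within S) v)"
  using assms unfolding smooth_on_def by (metis Ck_on.simps(2))

lemma differentiable_christoffel:
  assumes S: "open S" "x \<in> S" and G: "smooth_on S G"
    and inv: "\<And>y. y \<in> S \<Longrightarrow> invertible (G y)"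
  shows "(\<lambda>y. christoffel G y k i j) differentiable (at x)"
proof -
  have G1: "G differentiable (at y)" if "y \<in> S" for y
    using smooth_on_differentiable[OF G that] at_within_open[OF that S(1)] by simp
  \<comment> \<open>On the open set \<open>S\<close> these partial derivatives are entries of the
    Frechet derivative of \<open>G\<close>, which is itself smooth on \<open>S\<close>.\<close>
  have pd: "(\<lambda>y. partial_deriv i (\<lambda>y. G y $ j $ l) y) differentiable (at x)" for i j l
  proof (rule differentiable_transform_open[OF _ S])
    show "(\<lambda>y. frechet_derivative G (at y within S) (axis i 1) $ j $ l) differentiable (at x)"
      using smooth_on_differentiable[OF smooth_on_frechet_derivative[OF G] S(2)] at_within_open[OF S(2,1)]
      by (intro differentiable_vec_nth) simp
    show "frechet_derivative G (at y within S) (axis i 1) $ j $ l = partial_deriv i (\<lambda>y. G y $ j $ l) y"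
      if "y \<in> S" for y
      using has_derivative_partial_deriv[OF frechet_derivative_works[THEN iffD1, OF G1[OF that]]]
        at_within_open[OF that S(1)] by simp
  qed
  show ?thesis
    unfolding christoffel_def
    by (intro differentiable_mult differentiable_sum differentiable_const ballI finite_class.finite_UNIV
        differentiable_vec_nth[of "\<lambda>y. matrix_inv (G y)" for G, THEN differentiable_vec_nth]
        differentiable_matrix_inv[OF G1[OF S(2)] S inv] differentiable_diff differentiable_add pd)
qed

lemma bounded_linear_parts:
  "bounded_linear (base_part :: real^('n::finite + 'n) \<Rightarrow> _)"
  "bounded_linear (fibre_part :: real^('n::finite + 'n) \<Rightarrow> _)"
  by (auto simp: part_linear intro!: linearI linear_conv_bounded_linear[THEN iffD1])

text \<open>The metric is given by a definite description, but over the chart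
  \<open>is_berger_sasaki_at_ip\<close> expresses its entries through \<open>g\<close>, its inverse,
  \<open>J\<close> and the vertical parts of the basis vectors. The vertical parts bring in the
  Christoffel symbols; every ingredient is differentiable, and the formula holds on an open set
  around \<open>z\<close>.\<close>

lemma berger_sasaki_differentiable:
  fixes A :: "('i, 'a, 'n::finite) atlas"
  assumes g: "riemannian_metric A g" and J: "smooth_on (chart_image A c) (J c)"
    and c: "c \<in> charts A" and op: "open (chart_image A c)" and z: "base_part z \<in> chart_image A c"
  shows "berger_sasaki g J \<delta> c differentiable (at z)"
proof -
  define S where "S = (base_part :: real^('n + 'n) \<Rightarrow> _) -` chart_image A c"
  note bl = bounded_linear_parts
  have S: "open S" "z \<in> S"
    unfolding S_def using z op bl(1)
    by (auto intro!: open_vimage linear_continuous_on)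
  have dp: "base_part differentiable (at z)" "fibre_part differentiable (at z)"
    using bl by (auto intro: bounded_linear_imp_differentiable)
  have base: "(\<lambda>\<zeta>. f (base_part \<zeta>)) differentiable (at z)"
    if "f differentiable (at (base_part z))" for f :: "real^'n \<Rightarrow> 'd::real_normed_vector"
    using differentiable_compose[OF that dp(1)] .
  have sm: "smooth_on (chart_image A c) (g c)" using g c by (simp add: riemannian_metric_def)
  have inv: "invertible (g c y)" if "y \<in> chart_image A c" for y
    using g c that by (intro metric_ip_posdef_invertible) (auto simp: riemannian_metric_def)
  have dg: "g c differentiable (at (base_part z))" and dJ: "J c differentiable (at (base_part z))"
    using smooth_on_differentiable[OF sm z] smooth_on_differentiable[OF J z] at_within_open[OF z op] by auto
  have dH: "(\<lambda>\<zeta>. matrix_inv (g c (base_part \<zeta>))) differentiable (at z)"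
    by (rule base, rule differentiable_matrix_inv[OF dg op z inv])
  have dhor: "(\<lambda>\<zeta>. fibre_part (hor_lift (g c) \<zeta> X)) differentiable (at z)" for X
    unfolding hor_lift_def vec_pair_sel
  proof (rule differentiable_vecI)
    fix i
    show "(\<lambda>\<zeta>. (\<chi> i. \<Sum>h\<in>UNIV. \<Sum>j\<in>UNIV.
     fibre_part \<zeta> $ h * christoffel (g c) (base_part \<zeta>) h i j * X $ j) $ i) differentiable (at z)"
      unfolding vec_lambda_beta
      by (intro differentiable_sum ballI differentiable_mult differentiable_const finite_class.finite_UNIV
          base differentiable_christoffel[OF op z sm inv] differentiable_vec_nth[OF dp(2)])
  qed
  have dq: "(\<lambda>\<zeta>. vert_part (g c) \<zeta> W) differentiable (at z)" for W
    unfolding vert_part_def by (intro differentiable_diff differentiable_const dhor)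
  have dco: "(\<lambda>\<zeta>. cometric_ip (g c (base_part \<zeta>)) (u \<zeta>) (v \<zeta>)) differentiable (at z)"
    if "u differentiable (at z)" "v differentiable (at z)" for u v
    unfolding cometric_ip_def sharp_def
    by (intro differentiable_metric_ip differentiable_matrix_vector_mult base[OF dg] dH that)
  have dpJ: "(\<lambda>\<zeta>. covec_comp (fibre_part \<zeta>) (J c (base_part \<zeta>))) differentiable (at z)"
    unfolding covec_comp_def
    by (intro differentiable_matrix_vector_mult differentiable_transpose base[OF dJ] dp)
  show ?thesis
  proof (intro differentiable_vecI)
    fix i j
    let ?b = "\<lambda>\<zeta>. metric_ip (berger_sasaki g J \<delta> c \<zeta>) (axis j 1) (axis i 1)"
    have "?b differentiable (at z)"
      by (rule differentiable_transform_open[OF _ S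
            is_berger_sasaki_at_ip[OF berger_sasaki_spec[OF g c], symmetric]])
        (auto simp: S_def intro!: differentiable_add differentiable_mult differentiable_metric_ip
          dco dq dpJ base[OF dg])
    then show "(\<lambda>\<zeta>. berger_sasaki g J \<delta> c \<zeta> $ i $ j) differentiable (at z)"
      by (simp add: metric_ip_def inner_axis matrix_vector_mul_component)
  qed
qed

section \<open>Smooth curves and derivatives within intervals\<close>

text \<open>At a point of \<open>S\<close>, the derivative within \<open>S\<close> sees only values
  on \<open>S\<close>. Hence \<open>f\<close> and \<open>h\<close> have the same set of derivatives
  there, the chosen \<open>frechet_derivative\<close> is the same, and induction applies to
  it.\<close>

lemma Ck_on_cong:
  "(\<And>x. x \<in> S \<Longrightarrow> f x = h x) \<Longrightarrow> Ck_on k S f \<longleftrightarrow> Ck_on k S h"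
proof (induction k arbitrary: f h)
  case 0
  then show ?case by (auto cong: continuous_on_cong)
next
  case (Suc k)
  have eq: "(f has_derivative D) (at x within S) \<longleftrightarrow> (h has_derivative D) (at x within S)"
    if "x \<in> S" for x D
    using Suc.prems that has_derivative_transform[of x S] by metis
  then have "frechet_derivative f (at x within S) = frechet_derivative h (at x within S)" if "x \<in> S" for x
    using that by (simp add: frechet_derivative_def)
  then have "Ck_on k S (\<lambda>x. frechet_derivative f (at x within S) v) \<longleftrightarrow>
      Ck_on k S (\<lambda>x. frechet_derivative h (at x within S) v)" for v
    by (intro Suc.IH) simp
  then show ?case
    using eq by (auto simp: differentiable_on_def differentiable_def)
qed

lemma smooth_on_cong:
  "(\<And>x. x \<in> S \<Longrightarrow> f x = h x) \<Longrightarrow> smooth_on S f \<longleftrightarrow> smooth_on S h"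
  using Ck_on_cong[of S f h] by (auto simp: smooth_on_def)

text \<open>A linear map on the reals is determined by its value at 1. Nontriviality of the filter
  makes the derivative unique, so that this value is \<open>vector_derivative\<close>.\<close>

lemma frechet_derivative_real_within:
  fixes f :: "real \<Rightarrow> 'b::real_normed_vector"
  assumes "at t within S \<noteq> bot" "f differentiable (at t within S)"
  shows "frechet_derivative f (at t within S) v = v *\<^sub>R vector_derivative f (at t within S)"
proof -
  have D: "(f has_derivative frechet_derivative f (at t within S)) (at t within S)"
    using assms(2) by (simp add: frechet_derivative_works)
  have v: "frechet_derivative f (at t within S) v = v *\<^sub>R frechet_derivative f (at t within S) 1" for v
    using linear_cmul[OF has_derivative_linear[OF D], of v 1] by simp
  then have "(f has_vector_derivative frechet_derivative f (at t within S) 1) (at t within S)"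
    unfolding has_vector_derivative_def by (rule has_derivative_eq_rhs[OF D ext])
  then show ?thesis using vector_derivative_within[OF assms(1)] v by metis
qed

lemma has_vector_derivative_vec_pair:
  fixes f h :: "real \<Rightarrow> real^'n"
  assumes "(f has_vector_derivative f') (at t within S)" "(h has_vector_derivative h') (at t within S)"
  shows "((\<lambda>t. vec_pair (f t) (h t)) has_vector_derivative vec_pair f' h') (at t within S)"
proof -
  have "bounded_linear (\<lambda>w :: (real^'n) \<times> (real^'n). vec_pair (fst w) (snd w))"
    by (auto simp: vec_pair_linear intro!: linearI linear_conv_bounded_linear[THEN iffD1])
  from bounded_linear.has_vector_derivative[OF this has_vector_derivative_Pair[OF assms]]
  show ?thesis by simp
qed

text \<open>The derivative of a pair is the pair of derivatives, which feeds the induction. The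
  filter condition secures uniqueness, so that the equation holds for the derivatives selected by
  \<open>frechet_derivative\<close>.\<close>

lemma Ck_on_vec_pair:
  fixes f h :: "real \<Rightarrow> real^'n"
  assumes "\<And>t. t \<in> S \<Longrightarrow> at t within S \<noteq> bot"
  shows "Ck_on k S f \<Longrightarrow> Ck_on k S h \<Longrightarrow> Ck_on k S (\<lambda>t. vec_pair (f t) (h t))"
proof (induction k arbitrary: f h)
  case 0
  then show ?case
    unfolding vec_pair_def Ck_on.simps
    by (intro continuous_on_vec_lambda, case_tac i) (simp_all add: continuous_on_component)
next
  case (Suc k)
  let ?F = "\<lambda>t. vec_pair (f t) (h t)"
  have fh: "f differentiable (at t within S)" "h differentiable (at t within S)" if "t \<in> S" for t
    using Suc.prems that by (auto simp: differentiable_on_def)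
  have D: "(?F has_vector_derivative
      vec_pair (vector_derivative f (at t within S)) (vector_derivative h (at t within S))) (at t within S)"
    if "t \<in> S" for t
    using fh[OF that] by (intro has_vector_derivative_vec_pair) (simp_all add: vector_derivative_works)
  have diff: "?F differentiable (at t within S)" if "t \<in> S" for t
    using D[OF that] by (rule differentiableI_vector)
  have "frechet_derivative ?F (at t within S) v =
      vec_pair (frechet_derivative f (at t within S) v) (frechet_derivative h (at t within S) v)"
    if "t \<in> S" for t v
    using assms[OF that] fh[OF that] diff[OF that] vector_derivative_within[OF assms[OF that] D[OF that]]
    by (simp add: frechet_derivative_real_within vec_pair_linear)
  moreover have "Ck_on k S (\<lambda>t. vec_pair (frechet_derivative f (at t within S) v)
      (frechet_derivative h (at t within S) v))" for v
    using Suc.IH Suc.prems by auto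
  ultimately have "Ck_on k S (\<lambda>t. frechet_derivative ?F (at t within S) v)" for v
    by (subst Ck_on_cong) auto
  then show ?case
    using diff by (auto simp: differentiable_on_def)
qed

lemma smooth_on_vec_pair:
  fixes f h :: "real \<Rightarrow> real^'n"
  assumes "\<And>t. t \<in> S \<Longrightarrow> at t within S \<noteq> bot" "smooth_on S f" "smooth_on S h"
  shows "smooth_on S (\<lambda>t. vec_pair (f t) (h t))"
  using assms(2,3) Ck_on_vec_pair[OF assms(1)] unfolding smooth_on_def by blast

text \<open>Curves are smooth on the part of \<open>I\<close> that a chart sees, whereas velocities
  are derivatives within all of \<open>I\<close>; this passes from one to the other.\<close>

lemma at_within_openin:
  assumes "openin (top_of_set I) T" "t \<in> T"
  shows "at t within T = at t within I"
proof -
  obtain U where "open U" "T = I \<inter> U" using assms(1) by (auto simp: openin_open)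
  with assms(2) show ?thesis by (intro at_within_nhd[of t U]) auto
qed

text \<open>A connected set with more than one point has no isolated points. This makes derivatives
  unique at end points of \<open>I\<close> as well.\<close>

lemma at_within_interval_nontrivial:
  fixes I :: "real set"
  assumes "is_interval I" "\<exists>a\<in>I. \<exists>b\<in>I. a < b" "t \<in> I"
  shows "at t within I \<noteq> bot"
proof -
  have "I \<noteq> {x}" for x using assms(2) by auto
  then have "t islimpt I"
    using assms by (intro connected_imp_perfect) (auto simp: is_interval_connected)
  then show ?thesis by (simp add: trivial_limit_within)
qed

lemma smooth_on_vector_derivative_differentiable:
  assumes f: "smooth_on T f" and T: "openin (top_of_set I) T" and t: "t \<in> T"
    and lim: "\<And>s. s \<in> T \<Longrightarrow> at s within I \<noteq> bot"
  shows "(\<lambda>s. vector_derivative f (at s within I)) differentiable (at t within I)"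
proof -
  note eq = at_within_openin[OF T]
  have "(\<lambda>s. frechet_derivative f (at s within T) 1) differentiable (at t within T)"
    by (rule smooth_on_differentiable[OF smooth_on_frechet_derivative[OF f] t])
  moreover have "frechet_derivative f (at s within T) 1 = vector_derivative f (at s within I)" if "s \<in> T" for s
    using frechet_derivative_real_within[of s T f 1] smooth_on_differentiable[OF f that] lim[OF that] eq[OF that]
    by simp
  ultimately have "(\<lambda>s. vector_derivative f (at s within I)) differentiable (at t within T)"
    using differentiable_transform_within[OF _ zero_less_one t] by (metis (no_types, lifting))
  then show ?thesis by (simp add: eq[OF t])
qed

section \<open>First-order comparison of the deformed metric with the base metric\<close>

lemma cometric_ip_0 [simp]: "cometric_ip G 0 \<omega> = 0" "cometric_ip G \<omega> 0 = 0"
  by (simp_all add: cometric_ip_def sharp_def metric_ip_def)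

lemma has_derivative_metric_ip:
  assumes "(M has_derivative M') F"
  shows "((\<lambda>z. metric_ip (M z) u v) has_derivative (\<lambda>Y. metric_ip (M' Y) u v)) F"
  unfolding metric_ip_def
  by (intro has_derivative_inner_left bounded_linear.has_derivative[OF
    bounded_bilinear.bounded_linear_left[OF bounded_bilinear_matrix_vector_mult]] assms)

text \<open>The coordinate vector \<open>W\<close> is frozen while the point varies, so it is
  horizontal at \<open>z\<close> but in general not nearby. The excess of its deformed square length
  over that of its base part is a sum of nonnegative terms vanishing at \<open>z\<close>; this is a
  minimum, and all directional derivatives of the excess are zero.\<close>

lemma berger_sasaki_derivative_horizontal:
  fixes A :: "('i, 'a, 'n::finite) atlas"
  assumes g: "riemannian_metric A g" and c: "c \<in> charts A"
    and op: "open (chart_image A c)" and z: "base_part z \<in> chart_image A c"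
    and G': "(g c has_derivative G') (at (base_part z))"
    and B': "(berger_sasaki g J \<delta> c has_derivative B') (at z)"
    and hor: "vert_part (g c) z W = 0"
  shows "metric_ip (B' Y) W W = metric_ip (G' (base_part Y)) (base_part W) (base_part W)"
proof -
  define S where "S = (base_part :: real^('n + 'n) \<Rightarrow> _) -` chart_image A c"
  define f where "f \<zeta> = metric_ip (berger_sasaki g J \<delta> c \<zeta>) W W
    - metric_ip (g c (base_part \<zeta>)) (base_part W) (base_part W)" for \<zeta>
  have S: "z \<in> S" "open S"
    unfolding S_def using z op bounded_linear_parts(1)
    by (auto intro!: open_vimage linear_continuous_on)
  have "((\<lambda>\<zeta>. g c (base_part \<zeta>)) has_derivative (\<lambda>Y. G' (base_part Y))) (at z)"
    using G' by (rule has_derivative_compose[OF bounded_linear_imp_has_derivative[OF bounded_linear_parts(1)]])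
  then have f': "(f has_derivative (\<lambda>Y. metric_ip (B' Y) W W
      - metric_ip (G' (base_part Y)) (base_part W) (base_part W))) (at z)"
    unfolding f_def by (intro has_derivative_diff has_derivative_metric_ip B')
  have nonneg: "metric_ip (g c y) X X \<ge> 0" if "y \<in> chart_image A c" for y X
    using g c that by (cases "X = 0") (auto simp: riemannian_metric_def metric_ip_def less_imp_le)
  \<comment> \<open>The base term of the explicit formula cancels against the one subtracted in
    \<open>f\<close>; with equal arguments the deformation term is a square.\<close>
  have f_eq: "f \<zeta> = cometric_ip (g c (base_part \<zeta>)) (vert_part (g c) \<zeta> W) (vert_part (g c) \<zeta> W)
      + \<delta>\<^sup>2 * (cometric_ip (g c (base_part \<zeta>)) (vert_part (g c) \<zeta> W)
          (covec_comp (fibre_part \<zeta>) (J c (base_part \<zeta>))))\<^sup>2" if "\<zeta> \<in> S" for \<zeta>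
    using is_berger_sasaki_at_ip[OF berger_sasaki_spec[OF g c, of \<zeta>], of J \<delta> W W] that
    by (simp add: f_def S_def power2_eq_square)
  have "f z \<le> f \<zeta>" if "\<zeta> \<in> S" for \<zeta>
    using that nonneg[of "base_part \<zeta>"]
    by (simp add: f_eq S(1) hor) (simp add: S_def cometric_ip_def)
  with differential_zero_maxmin[OF S f'] show ?thesis
    by (auto simp: fun_eq_iff)
qed

section \<open>The horizontal lift in the charts of the cotangent bundle\<close>

theorem corollary5p3:
  fixes A :: "('i, 'a, 'n::finite) atlas"
    and J g :: "('i, 'n) matrix_field"
    and m :: nat and \<delta> :: real
    and I :: "real set" and \<gamma> :: "real \<Rightarrow> 'a"
    and C :: "real \<Rightarrow> 'a \<times> ('i \<Rightarrow> real^'n)"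
  assumes "kaehler_manifold m A J g"
    and "geodesic A g I \<gamma>"
    and "horizontal_lift A g I \<gamma> C"
  shows "geodesic (cotangent_bundle A) (berger_sasaki g J \<delta>) I C"
proof -
  let ?TA = "cotangent_bundle A"
  let ?B = "berger_sasaki g J \<delta>"
  define T where "T c = {t \<in> I. \<gamma> t \<in> chart_dom A c}" for c
  have g: "riemannian_metric A g"
    and op: "\<And>c. c \<in> charts A \<Longrightarrow> open (chart_image A c)"
    and J: "\<And>c. c \<in> charts A \<Longrightarrow> smooth_on (chart_image A c) (J c)"
    using assms(1) by (auto simp: kaehler_manifold_def smooth_manifold_def almost_complex_structure_def)
  have \<gamma>: "smooth_curve A I \<gamma>"
    and cov0: "\<And>c t. c \<in> charts A \<Longrightarrow> t \<in> T c \<Longrightarrow>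
        cov_deriv_vector A g I \<gamma> c (velocity A I \<gamma> c) t = 0"
    using assms(2) by (auto simp: geodesic_def T_def)
  from \<gamma> have I: "is_interval I" "\<exists>a\<in>I. \<exists>b\<in>I. a < b"
    and pts: "\<gamma> ` I \<subseteq> points A"
    and T: "\<And>c. c \<in> charts A \<Longrightarrow> openin (top_of_set I) (T c)"
    and sm: "\<And>c. c \<in> charts A \<Longrightarrow> smooth_on (T c) (chart_map A c \<circ> \<gamma>)"
    by (auto simp: smooth_curve_def T_def)
  obtain \<theta> where C: "\<And>t. t \<in> I \<Longrightarrow> C t = (\<gamma> t, \<theta> t)"
    and \<theta>: "\<And>t. t \<in> I \<Longrightarrow> \<theta> t \<in> cotangent_space A (\<gamma> t)"
    and sm\<theta>: "\<And>c. c \<in> charts A \<Longrightarrow> smooth_on (T c) (\<lambda>t. \<theta> t c)"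
    and par: "\<And>c t. c \<in> charts A \<Longrightarrow> t \<in> T c \<Longrightarrow> cov_deriv_covector A g I \<gamma> c (\<lambda>s. \<theta> s c) t = 0"
    using assms(3) by (auto simp: horizontal_lift_def covector_field_along_def T_def)
  have lim: "at t within I \<noteq> bot" if "t \<in> I" for t
    using at_within_interval_nontrivial[OF I that] .
  have TI: "T c \<subseteq> I" for c by (auto simp: T_def)
  have atT: "at t within T c = at t within I" if "c \<in> charts A" "t \<in> T c" for c t
    using at_within_openin[OF T] that by blast
  have TA: "charts ?TA = charts A" by (simp add: cotangent_bundle_def)
  \<comment> \<open>Since \<open>\<theta> t\<close> is a covector at \<open>\<gamma> t\<close>, a
    chart of the bundle contains \<open>C t\<close> as soon as the base chart contains
    \<open>\<gamma> t\<close>; both curves thus share the parameter sets \<open>T c\<close>.\<close>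
  have dom: "C t \<in> chart_dom ?TA c \<longleftrightarrow> \<gamma> t \<in> chart_dom A c" if "t \<in> I" for t c
    using C[OF that] \<theta>[OF that] by (simp add: cotangent_bundle_def)
  have map: "(chart_map ?TA c \<circ> C) t = vec_pair (chart_map A c (\<gamma> t)) (\<theta> t c)" if "t \<in> I" for t c
    using C[OF that] by (simp add: cotangent_bundle_def)
  have domT: "{t \<in> I. C t \<in> chart_dom ?TA c} = T c" for c
    using dom by (auto simp: T_def)
  have smC: "smooth_on (T c) (chart_map ?TA c \<circ> C)" if c: "c \<in> charts A" for c
  proof -
    have "smooth_on (T c) (\<lambda>t. vec_pair ((chart_map A c \<circ> \<gamma>) t) (\<theta> t c))"
      using lim TI atT[OF c] by (intro smooth_on_vec_pair sm sm\<theta> c) auto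
    then show ?thesis
      using map TI by (subst smooth_on_cong) auto
  qed
  have "C ` I \<subseteq> points ?TA"
    using pts dom by (fastforce simp: points_def TA)
  then have "smooth_curve ?TA I C"
    unfolding smooth_curve_def domT TA using I T smC by blast
  moreover have "cov_deriv_vector ?TA ?B I C c (velocity ?TA I C c) t = 0"
    if c: "c \<in> charts A" and t: "t \<in> T c" for c t
  proof -
    define x where "x = chart_map A c \<circ> \<gamma>"
    define z where "z = chart_map ?TA c \<circ> C"
    define V where "V = velocity A I \<gamma> c"
    define W where "W = velocity ?TA I C c"
    have xs: "x s \<in> chart_image A c" if "s \<in> T c" for s
      using that by (auto simp: x_def T_def chart_image_def)
    have z: "z s = vec_pair (x s) (\<theta> s c)" if "s \<in> I" for s
      using map[OF that] by (simp add: z_def x_def)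
    have diff_within: "f differentiable (at s within I)"
      if "smooth_on (T c) f" "s \<in> T c" for f :: "real \<Rightarrow> real^'k" and s
      using smooth_on_differentiable[OF that] atT[OF c that(2)] by simp
    \<comment> \<open>Parallelism prescribes the derivative of the fibre coordinates as exactly the
      fibre part of a horizontal lift. This is shown on all of \<open>T c\<close>, since products
      with \<open>W\<close> are differentiated below.\<close>
    have W: "W s = hor_lift (g c) (z s) (V s)" if s: "s \<in> T c" for s
    proof -
      let ?p = "vector_derivative (\<lambda>s. \<theta> s c) (at s within I)"
      have sI: "s \<in> I" using s TI by auto
      have "((\<lambda>s. vec_pair (x s) (\<theta> s c)) has_vector_derivative vec_pair (V s) ?p) (at s within I)"
        using diff_within[OF sm[OF c] s] diff_within[OF sm\<theta>[OF c] s]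
        by (intro has_vector_derivative_vec_pair)
          (simp_all add: x_def V_def velocity_def vector_derivative_works o_def)
      then have "(z has_vector_derivative vec_pair (V s) ?p) (at s within I)"
        by (rule has_vector_derivative_transform[OF sI, rotated]) (simp add: z)
      then have "W s = vec_pair (V s) ?p"
        using vector_derivative_within[OF lim[OF sI]] by (simp add: W_def velocity_def z_def)
      moreover have "?p = (\<chi> i. \<Sum>h\<in>UNIV. \<Sum>j\<in>UNIV. \<theta> s c $ h * christoffel (g c) (x s) h i j * V s $ j)"
        using par[OF c s] by (simp add: cov_deriv_covector_def V_def x_def mult_ac)
      ultimately show ?thesis by (simp add: hor_lift_def z[OF sI])
    qed
    have tI: "t \<in> I" using t TI by auto
    have zt: "base_part (z t) = x t" using z[OF tI] by simp
    have zS: "base_part (z s) \<in> chart_image A c" if "s \<in> T c" for s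
      using z[OF subsetD[OF TI that]] xs[OF that] by simp
    have posG: "\<And>y X. y \<in> chart_image A c \<Longrightarrow> X \<noteq> 0 \<Longrightarrow> metric_ip (g c y) X X > 0"
      and symG: "\<And>y. y \<in> chart_image A c \<Longrightarrow> transpose (g c y) = g c y"
      and smG: "smooth_on (chart_image A c) (g c)"
      using g c by (auto simp: riemannian_metric_def)
    obtain G' where G': "(g c has_derivative G') (at (x t))"
      using smooth_on_differentiable[OF smG xs[OF t]] at_within_open[OF xs[OF t] op[OF c]]
      by (auto simp: differentiable_def)
    obtain B' where B': "(?B c has_derivative B') (at (z t))"
      using berger_sasaki_differentiable[where J = J, OF g J[OF c] c op[OF c] zS[OF t]]
      by (auto simp: differentiable_def)
    note spec = berger_sasaki_spec[OF g c zS]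
    have posB: "Y \<noteq> 0 \<Longrightarrow> metric_ip (?B c (z t)) Y Y > 0" for Y
      using berger_sasaki_pos[OF g c zS[OF t]] .
    have symB: "transpose (?B c (z t)) = ?B c (z t)"
      using spec[OF t] by (auto simp: is_berger_sasaki_at_def)
    have diffV: "V differentiable (at t within I)"
      unfolding V_def velocity_def
      using lim TI by (intro smooth_on_vector_derivative_differentiable[OF sm[OF c] T[OF c] t]) auto
    have diffW: "W differentiable (at t within I)"
      unfolding W_def velocity_def
      using lim TI by (intro smooth_on_vector_derivative_differentiable[OF smC[OF c] T[OF c] t]) auto
    have "metric_ip (?B c (z t)) (cov_deriv_vector ?TA ?B I C c W t) Y = 0" for Y
    proof -
      \<comment> \<open>The geodesic equation on the base removes the covariant derivative
        term.\<close>
      have 1: "((\<lambda>s. metric_ip (g c (x s)) (base_part Y) (V s)) has_vector_derivative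
          1/2 * metric_ip (G' (base_part Y)) (V t) (V t)) (at t within I)"
        using has_vector_derivative_metric_ip_velocity[where A = A and \<gamma> = \<gamma> and g = g and c = c
            and t = t and I = I and Y = "base_part Y" and G' = G']
          G' metric_ip_posdef_invertible[OF posG[OF xs[OF t]]] symG[OF xs[OF t]] lim[OF tI]
          diff_within[OF sm[OF c] t] diffV cov0[OF c t]
        by (simp add: x_def V_def metric_ip_def)
      have 2: "((\<lambda>s. metric_ip (?B c (z s)) Y (W s)) has_vector_derivative
          metric_ip (?B c (z t)) (cov_deriv_vector ?TA ?B I C c W t) Y
            + 1/2 * metric_ip (B' Y) (W t) (W t)) (at t within I)"
        using has_vector_derivative_metric_ip_velocity[where A = ?TA and \<gamma> = C and g = ?B and c = c
            and t = t and I = I and Y = Y and G' = B']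
          B' metric_ip_posdef_invertible[OF posB] symB lim[OF tI]
          diff_within[OF smC[OF c] t] diffW
        by (simp add: z_def W_def)
      \<comment> \<open>The vertical part of \<open>W s\<close> is zero, so both cometric terms of
        the deformed product drop out whatever the vertical part of \<open>Y\<close> is.\<close>
      have "metric_ip (?B c (z s)) Y (W s) = metric_ip (g c (x s)) (base_part Y) (V s)"
        if "s \<in> T c" for s
        using is_berger_sasaki_at_ip[OF spec[OF that], of J \<delta> Y "W s"]
        by (simp add: W[OF that] z[OF subsetD[OF TI that]])
      then have "((\<lambda>s. metric_ip (?B c (z s)) Y (W s)) has_vector_derivative
          1/2 * metric_ip (G' (base_part Y)) (V t) (V t)) (at t within T c)"
        by (rule has_vector_derivative_transform[OF t _ 1[folded atT[OF c t]]])
      \<comment> \<open>The same function now has two expressions for its derivative at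
        \<open>t\<close>; they agree because the filter is nontrivial.\<close>
      then have "1/2 * metric_ip (G' (base_part Y)) (V t) (V t) =
          metric_ip (?B c (z t)) (cov_deriv_vector ?TA ?B I C c W t) Y
            + 1/2 * metric_ip (B' Y) (W t) (W t)"
        using vector_derivative_unique_within[OF lim[OF tI] _ 2] by (simp add: atT[OF c t])
      moreover have "metric_ip (B' Y) (W t) (W t) = metric_ip (G' (base_part Y)) (V t) (V t)"
        using berger_sasaki_derivative_horizontal[OF g c op[OF c] zS[OF t] _ B', of G' "W t" Y] G'
        by (simp add: W[OF t] zt)
      ultimately show ?thesis by simp
    qed
    \<comment> \<open>Taking \<open>Y\<close> to be the covariant derivative itself, positive
      definiteness forces it to be zero.\<close>
    then show ?thesis
      using posB unfolding W_def by (metis less_irrefl)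
  qed
  ultimately show ?thesis
    unfolding geodesic_def TA using dom by (auto simp: T_def)
qed

end
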